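(* Let $A,B>0$, $k\in\mathbb R\setminus\{0\}$, let $\chi_0$ be a triple spatial root, $F(\chi;\mu_0)=\mu_0(\chi-\chi_0)^3$, put $q_{\rm tri}=\chi_0/k$, and let $M_1,M_2\in\mathbb C$ with $M_2\neq0$ satisfy $$g_{11}|M_1|^2+g_{02}\operatorname{Re}M_2+\operatorname{Re}\left(g_{12}M_1^*M_2\right)+\frac{g_{22}}{4}|M_2|^2=0$$ (notation in context). Let $\mathcal P_j^{(T)}$ ($j=1,2$) be the plateau factors $$\mathcal P_j^{(T)}=\lim_{\substack{|t|\to\infty \\ x+t/(3k^2)=0}}\frac{u_j^{(R,3;\mathrm i)}(x,t)}{u_{j,0}(x,t)}=1+\frac{2|c_T|^2\lambda_0h_j(\chi_0)}{d_T},$$ and define $C_T=\dfrac{2|c_T|^2\lambda_0}{d_T}$. Then $$(1+q_{\rm tri})\big(\mathcal P_1^{(T)}-1\big)=(1-q_{\rm tri})\big(\mathcal P_2^{(T)}-1\big)=C_T .$$ Thus the two complex plateau factors are linked by one common parameter.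
   Context: $S=A+B$, $R=A-B$; $a_1,a_2\in\mathbb R$ with $a_1^2=A$, $a_2^2=B$; $k_1=k$, $k_2=-k$; $\omega_1=1/k-A$, $\omega_2=-1/k-B$; $u_{j,0}=a_j\exp[\mathrm i(k_jx+\omega_jt)]$ for $(x,t)\in\mathbb R^2$. $F(\chi;\mu)=\mu\chi^3-2\chi^2+k^2(S-\mu)\chi+k^2(2-kR)$. At a triple root automatically $\chi_0\in\mathbb R$, $0<\chi_0<|k|$, $\mu_0=\frac{2}{3\chi_0}>0$; $\lambda_0=\sqrt{\mu_0}>0$. $\nu(\chi)=\frac S2+\frac{2-kR}{2\chi}$, $\nu_\ell=\nu^{(\ell)}(\chi_0)$, $E(\chi)=\exp[\mathrm i(\chi x+\nu(\chi)t)]$, $h_1(\chi)=\frac{k}{k+\chi}$, $h_2(\chi)=\frac{k}{k-\chi}$, $\mathbf y(\chi,\lambda)=(\lambda E(\chi),u_{1,0}h_1(\chi)E(\chi),u_{2,0}h_2(\chi)E(\chi))^{\mathsf T}$, $\mathbf Y_n=\partial_\chi^n\mathbf y(\chi,\lambda_0)|_{\chi=\chi_0}$ (fixed $\lambda_0$), $E_n=\partial_\chi^nE(\chi)|_{\chi=\chi_0}$. $J=\operatorname{diag}(1,-1,-1)$, $K=I_3$, $\langle\mathbf f|M|\mathbf g\rangle=\mathbf f^\dagger M\mathbf g$; $g_{mn}=\langle\mathbf Y_m|J|\mathbf Y_n\rangle$ ($0\le m,n\le2$), real constants independent of $(x,t)$; $^*$ is complex conjugation. $D_0=\chi_0^3-k^2\chi_0$,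 $D_1=3\chi_0^2-k^2$, $\mathcal M_3=-\frac{3\chi_0M_2+D_1M_1+D_0}{\mu_0}$, $\mathcal M_4=-\frac{D_1M_2+D_0M_1}{\mu_0}$, $\mathcal M_5=-\frac{D_0M_2}{\mu_0}$. $$\mathbf y_R=(\psi_R,\phi_R,\varphi_R)^{\mathsf T}=\mathbf Y_0+M_1\mathbf Y_1+\tfrac{M_2}{2}\mathbf Y_2,\qquad \mathbf y_\mu=\tfrac1{2\lambda_0}\big(E_0+M_1E_1+\tfrac{M_2}{2}E_2,0,0\big)^{\mathsf T}+\tfrac{\mathcal M_3}{6}\mathbf Y_3+\tfrac{\mathcal M_4}{24}\mathbf Y_4+\tfrac{\mathcal M_5}{120}\mathbf Y_5,$$ $$m_R^{(3)}=\lambda_0\big(\langle\mathbf y_\mu|J|\mathbf y_R\rangle-\langle\mathbf y_R|J|\mathbf y_\mu\rangle\big)-\frac{\langle\mathbf y_R|K|\mathbf y_R\rangle}{2\lambda_0},\qquad \begin{pmatrix} u_1^{(R,3;\mathrm i)} \\ u_2^{(R,3;\mathrm i)} \end{pmatrix}=\begin{pmatrix} u_{1,0} \\ u_{2,0} \end{pmatrix}+\frac{2\psi_R^*}{m_R^{(3)}}\begin{pmatrix} \phi_R \\ \varphi_R \end{pmatrix}.$$ Constants: $\mathbf v_0=(\lambda_0,a_1h_1(\chi_0),a_2h_2(\chi_0))^{\mathsf T}$, $\mathbf v_n=(0,a_1h_1^{(n)}(\chi_0),a_2h_2^{(n)}(\chi_0))^{\mathsf T}$ for $n\ge1$; $c_T=\frac{\mathrm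 i\nu_2M_2}{2}$; $\mathbf r_T=\mathbf v_0+M_1\mathbf v_1+\frac{M_2}{2}\mathbf v_2$; $$\mathbf p_{T,2}=-\Big(\frac{\nu_2^2\mathcal M_4}{8}+\frac{\nu_2\nu_3\mathcal M_5}{12}\Big)\mathbf v_0-\frac{\nu_2^2\mathcal M_5}{8}\mathbf v_1,$$ $$\mathbf p_{T,1}=\frac{\mathrm i\nu_2M_2}{4\lambda_0}(1,0,0)^{\mathsf T}+\frac{\mathrm i\mathcal M_3}{6}(\nu_3\mathbf v_0+3\nu_2\mathbf v_1)+\frac{\mathrm i\mathcal M_4}{24}(\nu_4\mathbf v_0+4\nu_3\mathbf v_1+6\nu_2\mathbf v_2)+\frac{\mathrm i\mathcal M_5}{120}(\nu_5\mathbf v_0+5\nu_4\mathbf v_1+10\nu_3\mathbf v_2+10\nu_2\mathbf v_3);$$ $\zeta_{T,2}=c_T^*\langle\mathbf v_0|J|\mathbf p_{T,1}\rangle+\langle\mathbf r_T|J|\mathbf p_{T,2}\rangle$; $\kappa_0=\langle\mathbf v_0|K|\mathbf v_0\rangle$; $d_T=-\frac{|c_T|^2\kappa_0}{2\lambda_0}-2\mathrm i\lambda_0\operatorname{Im}\zeta_{T,2}$ (which is nonzero). *)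

theory Defs
  imports "HOL-Analysis.Analysis"
begin

definition herm_form :: "complex^'n \<Rightarrow> complex^'n^'n \<Rightarrow> complex^'n \<Rightarrow> complex" where
  "herm_form f M g = (\<Sum>i\<in>UNIV. cnj (f $ i) * (M *v g) $ i)"

definition J :: "complex^3^3" where
  "J = (\<chi> i j. if i = j then vector [1, -1, -1] $ i else 0)"

definition K :: "complex^3^3" where
  "K = mat 1"

text \<open>
  The locale only collects the parameters; it makes no assumptions. The spatial spectral
  variable, the root \<open>chi0\<close> and the parameter \<open>mu0\<close> are complex: that they are real and
  positive at a triple root is a consequence of the triple-root identity with \<open>A, B > 0\<close>
  and not part of the data. At a triple root \<open>csqrt mu0\<close> is therefore the positive square root. The
  derivatives in the spectral variable are iterated complex derivatives.
\<close>

locale triple_root_wave =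
  fixes A B k a1 a2 :: real
    and chi0 mu0 M1 M2 :: complex
begin

definition S :: real where "S = A + B"

definition R :: real where "R = A - B"

definition F :: "complex \<Rightarrow> complex \<Rightarrow> complex" where
  "F z m = m * z^3 - 2 * z^2 + of_real (k^2) * (of_real S - m) * z + of_real (k^2 * (2 - k * R))"

definition lam0 :: complex where "lam0 = csqrt mu0"

definition u10 :: "real \<Rightarrow> real \<Rightarrow> complex" where
  "u10 x t = of_real a1 * exp (\<i> * of_real (k * x + (1 / k - A) * t))"

definition u20 :: "real \<Rightarrow> real \<Rightarrow> complex" where
  "u20 x t = of_real a2 * exp (\<i> * of_real (- k * x + (- 1 / k - B) * t))"

definition nu :: "complex \<Rightarrow> complex" where
  "nu z = of_real S / 2 + of_real (2 - k * R) / (2 * z)"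

definition nu_d :: "nat \<Rightarrow> complex" where "nu_d l = (deriv ^^ l) nu chi0"

definition E :: "real \<Rightarrow> real \<Rightarrow> complex \<Rightarrow> complex" where
  "E x t z = exp (\<i> * (z * of_real x + nu z * of_real t))"

definition E_d :: "real \<Rightarrow> real \<Rightarrow> nat \<Rightarrow> complex" where
  "E_d x t n = (deriv ^^ n) (E x t) chi0"

definition h1 :: "complex \<Rightarrow> complex" where "h1 z = of_real k / (of_real k + z)"

definition h2 :: "complex \<Rightarrow> complex" where "h2 z = of_real k / (of_real k - z)"

definition y :: "real \<Rightarrow> real \<Rightarrow> complex \<Rightarrow> complex \<Rightarrow> complex^3" where
  "y x t z l = vector [l * E x t z, u10 x t * h1 z * E x t z, u20 x t * h2 z * E x t z]"

definition Y :: "real \<Rightarrow> real \<Rightarrow> nat \<Rightarrow> complex^3" where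
  "Y x t n = (\<chi> i. (deriv ^^ n) (\<lambda>z. y x t z lam0 $ i) chi0)"

text \<open>At a triple root \<open>g x t m n\<close> with \<open>m, n \<le> 2\<close> is real and does not depend on \<open>x, t\<close>;
  the arguments are kept because this is not built into the definition.\<close>

definition g :: "real \<Rightarrow> real \<Rightarrow> nat \<Rightarrow> nat \<Rightarrow> complex" where
  "g x t m n = herm_form (Y x t m) J (Y x t n)"

definition D0 :: complex where "D0 = chi0^3 - of_real (k^2) * chi0"

definition D1 :: complex where "D1 = 3 * chi0^2 - of_real (k^2)"

definition M3 :: complex where "M3 = - (3 * chi0 * M2 + D1 * M1 + D0) / mu0"

definition M4 :: complex where "M4 = - (D1 * M2 + D0 * M1) / mu0"

definition M5 :: complex where "M5 = - (D0 * M2) / mu0"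

definition yR :: "real \<Rightarrow> real \<Rightarrow> complex^3" where
  "yR x t = Y x t 0 + M1 *s Y x t 1 + (M2 / 2) *s Y x t 2"

definition ymu :: "real \<Rightarrow> real \<Rightarrow> complex^3" where
  "ymu x t = (1 / (2 * lam0)) *s vector [E_d x t 0 + M1 * E_d x t 1 + M2 / 2 * E_d x t 2, 0, 0]
     + (M3 / 6) *s Y x t 3 + (M4 / 24) *s Y x t 4 + (M5 / 120) *s Y x t 5"

definition mR :: "real \<Rightarrow> real \<Rightarrow> complex" where
  "mR x t = lam0 * (herm_form (ymu x t) J (yR x t) - herm_form (yR x t) J (ymu x t))
     - herm_form (yR x t) K (yR x t) / (2 * lam0)"

definition u1 :: "real \<Rightarrow> real \<Rightarrow> complex" where
  "u1 x t = u10 x t + 2 * cnj (yR x t $ 1) / mR x t * yR x t $ 2"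

definition u2 :: "real \<Rightarrow> real \<Rightarrow> complex" where
  "u2 x t = u20 x t + 2 * cnj (yR x t $ 1) / mR x t * yR x t $ 3"

definition v :: "nat \<Rightarrow> complex^3" where
  "v n = vector [if n = 0 then lam0 else 0,
     of_real a1 * (deriv ^^ n) h1 chi0, of_real a2 * (deriv ^^ n) h2 chi0]"

definition cT :: complex where "cT = \<i> * nu_d 2 * M2 / 2"

definition rT :: "complex^3" where "rT = v 0 + M1 *s v 1 + (M2 / 2) *s v 2"

definition pT2 :: "complex^3" where
  "pT2 = - ((nu_d 2 ^ 2 * M4 / 8 + nu_d 2 * nu_d 3 * M5 / 12) *s v 0)
     - (nu_d 2 ^ 2 * M5 / 8) *s v 1"

definition pT1 :: "complex^3" where
  "pT1 = (\<i> * nu_d 2 * M2 / (4 * lam0)) *s vector [1, 0, 0]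
     + (\<i> * M3 / 6) *s (nu_d 3 *s v 0 + (3 * nu_d 2) *s v 1)
     + (\<i> * M4 / 24) *s (nu_d 4 *s v 0 + (4 * nu_d 3) *s v 1 + (6 * nu_d 2) *s v 2)
     + (\<i> * M5 / 120) *s (nu_d 5 *s v 0 + (5 * nu_d 4) *s v 1 + (10 * nu_d 3) *s v 2
         + (10 * nu_d 2) *s v 3)"

definition zetaT2 :: complex where
  "zetaT2 = cnj cT * herm_form (v 0) J pT1 + herm_form rT J pT2"

definition kappa0 :: complex where "kappa0 = herm_form (v 0) K (v 0)"

definition dT :: complex where
  "dT = - (of_real (cmod cT ^ 2) * kappa0 / (2 * lam0)) - 2 * \<i> * lam0 * of_real (Im zetaT2)"

definition CT :: complex where "CT = 2 * of_real (cmod cT ^ 2) * lam0 / dT"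

definition q_tri :: complex where "q_tri = chi0 / of_real k"

text \<open>The line \<open>x + t / (3 * k^2) = 0\<close> is parametrised by \<open>t\<close>; the filter \<open>at_infinity\<close>
  on the reals is the two-sided limit of \<open>\<bar>t\<bar>\<close> going to infinity.\<close>

definition ratio1 :: "real \<Rightarrow> complex" where
  "ratio1 t = u1 (- t / (3 * k^2)) t / u10 (- t / (3 * k^2)) t"

definition ratio2 :: "real \<Rightarrow> complex" where
  "ratio2 t = u2 (- t / (3 * k^2)) t / u20 (- t / (3 * k^2)) t"

definition P1 :: complex where "P1 = Lim at_infinity ratio1"

definition P2 :: complex where "P2 = Lim at_infinity ratio2"

end

end

theory Submission
  imports Defs "HOL-Complex_Analysis.Cauchy_Integral_Formula"
begin

text \<open>
  Comparing coefficients of the triple-root identity makes \<open>chi0 = c\<close> real and positive and gives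
  \<open>3 c k^3 A = (k + c)^3\<close> and \<open>3 c k^3 B = (k - c)^3\<close>. Hence \<open>v 0\<close> is \<open>J\<close>-isotropic and
  \<open>J\<close>-orthogonal to \<open>v 1\<close>. Since \<open>nu' chi0 = 1 / (3 k^2)\<close>, the phase is stationary at \<open>chi0\<close> along the
  line \<open>x = - t / (3 k^2)\<close>; up to a common unimodular diagonal factor \<open>yR\<close> and \<open>ymu\<close> are there
  polynomials in \<open>t\<close> of degree one and two. The cubic term of \<open>mR\<close> cancels by the two orthogonality
  relations, its quadratic coefficient is \<open>dT\<close>, and \<open>Re dT < 0\<close> because \<open>M2 \<noteq> 0\<close>.
\<close>

section \<open>Hermitian forms, unimodular factors and a limit of rational functions\<close>

lemma herm_form_J:
  "herm_form f J g = cnj (f $ 1) * g $ 1 - cnj (f $ 2) * g $ 2 - cnj (f $ 3) * g $ 3"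
  by (simp add: herm_form_def J_def matrix_vector_mult_def sum_3)

lemma herm_form_K:
  "herm_form f K g = cnj (f $ 1) * g $ 1 + cnj (f $ 2) * g $ 2 + cnj (f $ 3) * g $ 3"
  by (simp add: herm_form_def K_def sum_3)

lemma cnj_herm_form_J: "cnj (herm_form f J g) = herm_form g J f"
  by (simp add: herm_form_J mult.commute)

text \<open>\<open>J\<close> is diagonal, so componentwise unimodular factors shared by both
  arguments cancel. This removes the phases of \<open>yR\<close> and \<open>ymu\<close> from
  \<open>mR\<close>.\<close>

lemma herm_form_J_unitary:
  assumes "\<And>i. cnj (c i) * c i = 1" "\<And>i. f' $ i = c i * f $ i" "\<And>i. g' $ i = c i * g $ i"
  shows "herm_form f' J g' = herm_form f J g"
proof -
  have "cnj (f' $ i) * g' $ i = (cnj (c i) * c i) * (cnj (f $ i) * g $ i)" for i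
    by (simp add: assms(2,3))
  thus ?thesis
    by (simp add: herm_form_J assms(1))
qed

lemma herm_form_K_unitary:
  assumes "\<And>i. cnj (c i) * c i = 1" "\<And>i. f' $ i = c i * f $ i" "\<And>i. g' $ i = c i * g $ i"
  shows "herm_form f' K g' = herm_form f K g"
proof -
  have "cnj (f' $ i) * g' $ i = (cnj (c i) * c i) * (cnj (f $ i) * g $ i)" for i
    by (simp add: assms(2,3))
  thus ?thesis
    by (simp add: herm_form_K assms(1))
qed

lemma cnj_cis_mult: "cnj (exp (\<i> * of_real a)) * exp (\<i> * of_real a) = 1"
  by (simp add: exp_cnj flip: exp_add)

text \<open>After division by \<open>t^2\<close>, numerator and denominator are polynomials in
  \<open>1 / t\<close>, so only the leading coefficients survive.\<close>

lemma tendsto_plateau: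
  fixes a b c d m0 m1 m2 :: complex
  assumes "m2 \<noteq> 0"
  shows "((\<lambda>t::real. 1 + 2 * (a + of_real t * b) * (c + of_real t * d) / (m0 + of_real t * m1 + of_real t ^ 2 * m2))
    \<longlongrightarrow> 1 + 2 * b * d / m2) at_infinity"
proof -
  define s where "s = (\<lambda>t::real. of_real (inverse t) :: complex)"
  have s: "(s \<longlongrightarrow> 0) at_infinity"
    unfolding s_def using tendsto_of_real[OF tendsto_inverse_0[where 'a = real], where 'a = complex] by simp
  have "((\<lambda>t. 1 + 2 * (a * s t + b) * (c * s t + d) / (m0 * s t ^ 2 + m1 * s t + m2))
      \<longlongrightarrow> 1 + 2 * (a * 0 + b) * (c * 0 + d) / (m0 * 0 ^ 2 + m1 * 0 + m2)) at_infinity"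
    by (intro tendsto_intros s) (use assms in auto)
  hence lim: "((\<lambda>t. 1 + 2 * (a * s t + b) * (c * s t + d) / (m0 * s t ^ 2 + m1 * s t + m2))
      \<longlongrightarrow> 1 + 2 * b * d / m2) at_infinity"
    by simp
  have "\<forall>\<^sub>F t::real in at_infinity. t \<noteq> 0"
    unfolding eventually_at_infinity by (rule exI[of _ 1]) auto
  hence "\<forall>\<^sub>F t in at_infinity. 1 + 2 * (a * s t + b) * (c * s t + d) / (m0 * s t ^ 2 + m1 * s t + m2)
     = 1 + 2 * (a + of_real t * b) * (c + of_real t * d) / (m0 + of_real t * m1 + of_real t ^ 2 * m2)"
  proof eventually_elim
    case (elim t)
    define T where "T = (of_real t :: complex)"
    have T: "T \<noteq> 0" and sT: "s t = 1 / T"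
      using elim by (auto simp: T_def s_def field_simps)
    have "2 * (a * s t + b) * (c * s t + d) = (2 * (a + T * b) * (c + T * d)) / T ^ 2"
         "m0 * s t ^ 2 + m1 * s t + m2 = (m0 + T * m1 + T ^ 2 * m2) / T ^ 2"
      unfolding sT using T by (simp_all add: field_simps power2_eq_square)
    thus ?case
      unfolding T_def[symmetric] using T by simp
  qed
  thus ?thesis
    using lim by (rule Lim_transform_eventually[rotated])
qed

text \<open>
  The real part of the root is a parameter: as a definition it would itself depend on \<open>chi0\<close>,
  and rewriting with \<open>chi0 = of_real c\<close> would not terminate.
\<close>

locale triple_root = triple_root_wave +
  fixes c :: real
  assumes c_def: "c = Re chi0"
    and A_pos: "A > 0" and B_pos: "B > 0" and k_nz: "k \<noteq> 0"
    and a1_sq: "a1^2 = A" and a2_sq: "a2^2 = B"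
    and triple: "\<And>z. F z mu0 = mu0 * (z - chi0)^3"
    and M2_nz: "M2 \<noteq> 0"
begin

section \<open>Real parameters from the triple-root identity\<close>

lemma coefficients:
  "mu0 * chi0 = 2 / 3"
  "of_real (k^2 * S) = of_real (k^2) * mu0 + 2 * chi0"
  "of_real (k^2 * (2 - k * R)) = - 2 / 3 * chi0^2"
proof -
  have *: "mu0 * z^3 - 2 * z^2 + of_real (k^2) * (of_real S - mu0) * z + of_real (k^2 * (2 - k * R))
     = mu0 * (z - chi0)^3" for z
    using triple[of z] by (simp add: F_def)
  have f0: "of_real (k^2 * (2 - k * R)) = - mu0 * chi0^3"
    using *[of 0] by (simp add: power3_eq_cube)
  have p1: "mu0 - 2 + of_real (k^2) * (of_real S - mu0) + of_real (k^2 * (2 - k * R)) = mu0 * (1 - chi0)^3"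
    using *[of 1] by simp
  have n1: "- mu0 - 2 - of_real (k^2) * (of_real S - mu0) + of_real (k^2 * (2 - k * R)) = mu0 * (- 1 - chi0)^3"
    using *[of "-1"] by simp
  \<comment> \<open>Sum and difference of the values at 1 and -1 separate the even and the odd part
    of the cubic.\<close>
  have e1: "- 4 + 2 * of_real (k^2 * (2 - k * R)) = mu0 * (- 2 * chi0^3 - 6 * chi0)"
    using p1 n1 by algebra
  have e2: "2 * mu0 + 2 * of_real (k^2) * (of_real S - mu0) = mu0 * (2 + 6 * chi0^2)"
    using p1 n1 by algebra
  show m: "mu0 * chi0 = 2 / 3"
    using e1 f0 by algebra
  have "of_real (k^2) * of_real S = of_real (k^2) * mu0 + 2 * chi0"
    using e2 m by algebra
  thus "of_real (k^2 * S) = of_real (k^2) * mu0 + 2 * chi0"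
    by simp
  show "of_real (k^2 * (2 - k * R)) = - 2 / 3 * chi0^2"
    using f0 m by algebra
qed

lemma S_pos: "S > 0"
  using A_pos B_pos by (simp add: S_def)

lemma chi0_nz: "chi0 \<noteq> 0"
  using coefficients(1) by auto

text \<open>Multiplied by \<open>chi0\<close>, the relation for \<open>S\<close> becomes linear in
  \<open>chi0\<close> with real coefficients, because \<open>mu0 * chi0\<close> and
  \<open>chi0^2\<close> are real; \<open>S > 0\<close> permits the division.\<close>

lemma chi0_real: "chi0 = of_real c"
proof -
  define \<rho> where "\<rho> = - 3 / 2 * (k^2 * (2 - k * R))"
  have \<rho>: "chi0^2 = of_real \<rho>"
    using coefficients(3) by (simp add: \<rho>_def)
  have "of_real (k^2 * S) * chi0 = of_real (k^2) * (mu0 * chi0) + 2 * chi0^2"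
    using coefficients(2) by algebra
  also have "\<dots> = of_real (2 / 3 * k^2 + 2 * \<rho>)"
    by (simp add: coefficients(1) \<rho>)
  finally have *: "of_real (k^2 * S) * chi0 = of_real (2 / 3 * k^2 + 2 * \<rho>)" .
  have nz: "k^2 * S \<noteq> 0"
    using k_nz S_pos by simp
  have "chi0 = of_real ((2 / 3 * k^2 + 2 * \<rho>) / (k^2 * S))"
    using * nz by (simp only: of_real_divide) (simp add: field_simps del: of_real_mult)
  thus ?thesis
    unfolding c_def by (metis Re_complex_of_real)
qed

lemma c_nz: "c \<noteq> 0"
  using chi0_nz chi0_real by auto

lemma mu0_real: "mu0 = of_real (2 / (3 * c))"
  using coefficients(1) c_nz by (simp add: chi0_real field_simps)

lemma S_eq: "k^2 * S = 2 * k^2 / (3 * c) + 2 * c"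
proof -
  have "complex_of_real (k^2 * S) = of_real (2 * k^2 / (3 * c) + 2 * c)"
    using coefficients(2) by (simp add: mu0_real chi0_real)
  thus ?thesis
    by (simp only: of_real_eq_iff)
qed

lemma R_eq: "k^2 * (2 - k * R) = - 2 / 3 * c^2"
proof -
  have "complex_of_real (k^2 * (2 - k * R)) = of_real (- 2 / 3 * c^2)"
    using coefficients(3) by (simp add: chi0_real)
  thus ?thesis
    by (simp only: of_real_eq_iff)
qed

text \<open>The right-hand side of \<open>S_eq\<close> would be nonpositive otherwise, against
  \<open>S > 0\<close>.\<close>

lemma c_pos: "c > 0"
proof (rule ccontr)
  assume "\<not> c > 0"
  hence "2 * k^2 / (3 * c) + 2 * c \<le> 0"
    by (simp add: divide_nonneg_nonpos add_nonpos_nonpos)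
  thus False
    using S_eq S_pos k_nz by (metis mult_pos_pos not_less zero_less_power2)
qed

text \<open>\<open>S\<close> supplies the terms of the cube that are even in \<open>c\<close>, and
  \<open>R\<close> the odd ones; with the opposite sign of \<open>R\<close> the same terms give
  \<open>B_eq\<close>.\<close>

lemma A_eq: "3 * c * k^3 * A = (k + c)^3"
proof -
  have "3 * c * (k^2 * S) = 2 * k^2 + 6 * c^2"
    using S_eq c_pos by (simp add: field_simps power2_eq_square)
  moreover have "A = (S + R) / 2"
    by (simp add: S_def R_def)
  ultimately show ?thesis
    using R_eq by algebra
qed

lemma B_eq: "3 * c * k^3 * B = (k - c)^3"
proof -
  have "3 * c * (k^2 * S) = 2 * k^2 + 6 * c^2"
    using S_eq c_pos by (simp add: field_simps power2_eq_square)
  moreover have "B = (S - R) / 2"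
    by (simp add: S_def R_def)
  ultimately show ?thesis
    using R_eq by algebra
qed

text \<open>By \<open>A_eq\<close> a zero here would force \<open>A = 0\<close>; hence
  \<open>chi0\<close> is not a pole of \<open>h1\<close>.\<close>

lemma k_plus_nz: "k + c \<noteq> 0"
  using A_eq A_pos c_pos k_nz by (metis mult_eq_0_iff power_eq_0_iff less_numeral_extra(3) zero_neq_numeral zero_less_numeral)

lemma k_minus_nz: "k - c \<noteq> 0"
  using B_eq B_pos c_pos k_nz by (metis mult_eq_0_iff power_eq_0_iff less_numeral_extra(3) zero_neq_numeral zero_less_numeral)

lemma k_chi0_nz: "of_real k + chi0 \<noteq> 0" "of_real k - chi0 \<noteq> 0"
  using k_plus_nz k_minus_nz
  by (simp_all add: chi0_real del: of_real_add of_real_diff flip: of_real_add of_real_diff)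

section \<open>The square root \<open>lam0\<close> and the spectral functions at the root\<close>

definition L :: real where "L = sqrt (2 / (3 * c))"

lemma L_pos: "L > 0"
  using c_pos by (simp add: L_def)

lemma L_sq: "L^2 = 2 / (3 * c)"
  using c_pos by (simp add: L_def)

lemma lam0_eq: "lam0 = of_real L"
proof -
  have "csqrt (of_real (2 / (3 * c))) = of_real (sqrt (2 / (3 * c)))"
    using c_pos by (subst csqrt_of_real_nonneg) simp_all
  thus ?thesis
    by (simp only: lam0_def L_def flip: mu0_real)
qed

lemma h_analytic: "h1 analytic_on {chi0}" "h2 analytic_on {chi0}"
  unfolding h1_def h2_def using k_chi0_nz by (auto intro!: analytic_intros)

lemma nu_analytic: "nu analytic_on {chi0}"
  unfolding nu_def using chi0_nz by (auto intro!: analytic_intros)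

lemma E_analytic: "E x t analytic_on {chi0}"
  unfolding E_def by (intro analytic_intros nu_analytic)

lemma deriv_h1: "deriv h1 chi0 = of_real (- k / (k + c)^2)"
proof -
  have "(h1 has_field_derivative - of_real k / (of_real k + chi0)^2) (at chi0)"
    unfolding h1_def using k_chi0_nz
    by (auto intro!: derivative_eq_intros simp: power2_eq_square)
  thus ?thesis
    by (simp add: DERIV_imp_deriv chi0_real)
qed

lemma deriv_h2: "deriv h2 chi0 = of_real (k / (k - c)^2)"
proof -
  have "(h2 has_field_derivative of_real k / (of_real k - chi0)^2) (at chi0)"
    unfolding h2_def using k_chi0_nz
    by (auto intro!: derivative_eq_intros simp: power2_eq_square)
  thus ?thesis
    by (simp add: DERIV_imp_deriv chi0_real)
qed

lemma h1_chi0: "h1 chi0 = of_real (k / (k + c))"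
  by (simp add: h1_def chi0_real)

lemma h2_chi0: "h2 chi0 = of_real (k / (k - c))"
  by (simp add: h2_def chi0_real)

lemma nu_chi0: "nu chi0 = of_real (S / 2 + (2 - k * R) / (2 * c))"
  by (simp add: nu_def chi0_real)

text \<open>\<open>R_eq\<close> eliminates \<open>R\<close> from the derivative. The formula is
  given off 0, not only at \<open>chi0\<close>, so that it can be differentiated again.\<close>

lemma deriv_nu:
  assumes "z \<noteq> 0"
  shows "deriv nu z = of_real (c^2 / (3 * k^2)) / z^2"
proof -
  have r: "2 - k * R = - 2 * c^2 / (3 * k^2)"
    using R_eq k_nz by (simp add: field_simps)
  have "(nu has_field_derivative of_real (c^2 / (3 * k^2)) / z^2) (at z)"
    unfolding nu_def r using assms k_nz
    by (auto intro!: derivative_eq_intros simp: field_simps power2_eq_square)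
  thus ?thesis
    by (rule DERIV_imp_deriv)
qed

text \<open>This value fixes the line \<open>x = - t / (3 * k^2)\<close> as the one on which the
  phase is stationary.\<close>

lemma nu_d_1: "nu_d 1 = of_real (1 / (3 * k^2))"
proof -
  have "nu_d 1 = deriv nu chi0"
    by (simp add: nu_d_def)
  thus ?thesis
    using c_pos deriv_nu[OF chi0_nz] by (simp add: chi0_real)
qed

lemma nu_d_2: "nu_d 2 = of_real (- 2 / (3 * k^2 * c))"
proof -
  have "\<forall>\<^sub>F z in nhds chi0. deriv nu z = of_real (c^2 / (3 * k^2)) / z^2"
    by (rule eventually_mono[OF t1_space_nhds[OF chi0_nz]]) (rule deriv_nu)
  hence "deriv (deriv nu) chi0 = deriv (\<lambda>z. of_real (c^2 / (3 * k^2)) / z^2) chi0"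
    by (intro deriv_cong_ev) auto
  also have "\<dots> = of_real (c^2 / (3 * k^2)) * (- 2 / chi0^3)"
    by (rule DERIV_imp_deriv)
      (use chi0_nz k_nz in \<open>auto intro!: derivative_eq_intros simp: field_simps power2_eq_square power3_eq_cube\<close>)
  also have "\<dots> = of_real (- 2 / (3 * k^2 * c))"
    using c_pos k_nz by (simp add: chi0_real field_simps power2_eq_square power3_eq_cube)
  finally show ?thesis
    by (simp add: nu_d_def numeral_2_eq_2)
qed

lemma nu_d_2_nz: "nu_d 2 \<noteq> 0"
  unfolding nu_d_2 using k_nz c_pos by (simp add: divide_eq_0_iff del: of_real_divide of_real_minus of_real_mult)

section \<open>Derivatives of \<open>E\<close> along the stationary line\<close>

text \<open>Leibniz rule for \<open>E' = f E\<close> with the logarithmic derivative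
  \<open>f = i (x + nu' t)\<close>; \<open>x\<close> survives only in the undifferentiated
  \<open>f\<close>, hence the case \<open>j = 0\<close>.\<close>

lemma E_d_Suc:
  "E_d x t (Suc n) = (\<Sum>j=0..n. of_nat (n choose j) *
     (\<i> * ((if j = 0 then of_real x else 0) + nu_d (Suc j) * of_real t)) * E_d x t (n - j))"
proof -
  define f where "f = (\<lambda>z. \<i> * of_real x + (\<i> * of_real t) * deriv nu z)"
  have an: "deriv nu analytic_on {chi0}"
    by (intro analytic_intros nu_analytic)
  have fan: "f analytic_on {chi0}"
    unfolding f_def by (intro analytic_intros an)
  \<comment> \<open>Higher derivatives need \<open>E' = f E\<close> on a whole neighbourhood, and
    \<open>nu\<close> is differentiable away from 0.\<close>
  have "\<forall>\<^sub>F z in nhds chi0. z \<noteq> 0"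
    by (rule t1_space_nhds[OF chi0_nz])
  hence "\<forall>\<^sub>F z in nhds chi0. deriv (E x t) z = f z * E x t z"
  proof eventually_elim
    case (elim z)
    have "(nu has_field_derivative deriv nu z) (at z)"
      unfolding nu_def using elim by (intro analytic_derivI analytic_intros) auto
    hence "(E x t has_field_derivative f z * E x t z) (at z)"
      unfolding E_def f_def
      by (auto intro!: derivative_eq_intros simp: algebra_simps)
    thus ?case
      by (rule DERIV_imp_deriv)
  qed
  hence "(deriv ^^ n) (deriv (E x t)) chi0 = (deriv ^^ n) (\<lambda>z. f z * E x t z) chi0"
    by (intro higher_deriv_cong_ev) auto
  also have "\<dots> = (\<Sum>j=0..n. of_nat (n choose j) * (deriv ^^ j) f chi0 * E_d x t (n - j))"
    unfolding E_d_def by (rule higher_deriv_mult_at[OF fan E_analytic])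
  finally have leibniz: "E_d x t (Suc n) =
      (\<Sum>j=0..n. of_nat (n choose j) * (deriv ^^ j) f chi0 * E_d x t (n - j))"
    unfolding E_d_def funpow_Suc_right o_def .
  have "(deriv ^^ j) f chi0 = \<i> * ((if j = 0 then of_real x else 0) + nu_d (Suc j) * of_real t)" for j
  proof -
    have "(deriv ^^ j) f chi0 = (deriv ^^ j) (\<lambda>z. \<i> * of_real x) chi0
        + (deriv ^^ j) (\<lambda>z. (\<i> * of_real t) * deriv nu z) chi0"
      unfolding f_def by (rule higher_deriv_add_at) (intro analytic_intros an)+
    also have "(deriv ^^ j) (\<lambda>z. (\<i> * of_real t) * deriv nu z) chi0 = \<i> * of_real t * nu_d (Suc j)"
      unfolding nu_d_def funpow_Suc_right o_def by (rule higher_deriv_cmult'[OF an])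
    finally show ?thesis
      by (simp add: algebra_simps)
  qed
  thus ?thesis
    by (simp only: leibniz)
qed

lemma E_d_0: "E_d x t 0 = E x t chi0"
  by (simp add: E_d_def)

lemma stationary: "complex_of_real (- t / (3 * k^2)) + nu_d (Suc 0) * of_real t = 0"
  using nu_d_1 by simp

text \<open>On the line the \<open>j = 0\<close> term of the recursion vanishes. Each power of
  \<open>t\<close> then costs at least two derivatives, so the first five have degree at most two in
  \<open>t\<close>.\<close>

lemma E_d_stationary:
  fixes t :: real
  defines "x \<equiv> - t / (3 * k^2)" and "T \<equiv> complex_of_real t"
  shows "E_d x t 1 = 0"
    "E_d x t 2 = E x t chi0 * (\<i> * nu_d 2 * T)"
    "E_d x t 3 = E x t chi0 * (\<i> * nu_d 3 * T)"
    "E_d x t 4 = E x t chi0 * (\<i> * nu_d 4 * T - 3 * nu_d 2 ^ 2 * T^2)"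
    "E_d x t 5 = E x t chi0 * (\<i> * nu_d 5 * T - 10 * nu_d 2 * nu_d 3 * T^2)"
proof -
  have st: "complex_of_real x + nu_d (Suc 0) * T = 0"
    unfolding x_def T_def by (rule stationary)
  show 1: "E_d x t 1 = 0"
    using E_d_Suc[of x t 0] st by (simp add: T_def)
  show 2: "E_d x t 2 = E x t chi0 * (\<i> * nu_d 2 * T)"
    using E_d_Suc[of x t 1] st 1 by (simp add: T_def E_d_0 eval_nat_numeral)
  show 3: "E_d x t 3 = E x t chi0 * (\<i> * nu_d 3 * T)"
    using E_d_Suc[of x t 2] st 1 2 by (simp add: T_def E_d_0 eval_nat_numeral)
  have "E_d x t 4 = \<i> * nu_d 4 * T * E x t chi0 + 3 * (\<i> * nu_d 2 * T) * E_d x t 2"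
    using E_d_Suc[of x t 3] st 1 by (simp add: T_def E_d_0 eval_nat_numeral)
  thus "E_d x t 4 = E x t chi0 * (\<i> * nu_d 4 * T - 3 * nu_d 2 ^ 2 * T^2)"
    unfolding 2 by (simp add: algebra_simps power2_eq_square)
  \<comment> \<open>The quadratic contributions have weights 6 and 4, which add up to the 10
    below.\<close>
  have "E_d x t 5 = \<i> * nu_d 5 * T * E x t chi0 + 6 * (\<i> * nu_d 3 * T) * E_d x t 2
      + 4 * (\<i> * nu_d 2 * T) * E_d x t 3"
    using E_d_Suc[of x t 4] st 1 by (simp add: T_def E_d_0 eval_nat_numeral)
  thus "E_d x t 5 = E x t chi0 * (\<i> * nu_d 5 * T - 10 * nu_d 2 * nu_d 3 * T^2)"
    unfolding 2 3 by (simp add: algebra_simps power2_eq_square)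
qed

section \<open>The vectors \<open>yR\<close> and \<open>ymu\<close> on the line\<close>

text \<open>The background phases without their amplitudes. The first entry is 1 because the first
  component of \<open>y\<close> carries no background.\<close>

definition w :: "real \<Rightarrow> real \<Rightarrow> complex^3" where
  "w x t = vector [1, exp (\<i> * of_real (k * x + (1 / k - A) * t)),
     exp (\<i> * of_real (- k * x + (- 1 / k - B) * t))]"

lemma u10_w: "u10 x t = of_real a1 * w x t $ 2"
  and u20_w: "u20 x t = of_real a2 * w x t $ 3"
  by (simp_all add: u10_def u20_def w_def)

lemma E_chi0: "E x t chi0 = exp (\<i> * of_real (c * x + (S / 2 + (2 - k * R) / (2 * c)) * t))"
  unfolding E_def nu_chi0 by (simp add: chi0_real)

lemma phase_unit: "cnj (E x t chi0 * w x t $ i) * (E x t chi0 * w x t $ i) = 1"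
proof -
  have "cnj (w x t $ i) * (w x t $ i) = 1"
    using exhaust_3[of i] cnj_cis_mult by (auto simp only: w_def vector_3 complex_cnj_one mult_1)
  moreover have "cnj (E x t chi0) * E x t chi0 = 1"
    unfolding E_chi0 by (rule cnj_cis_mult)
  ultimately show ?thesis
    by (metis complex_cnj_mult mult.assoc mult.left_commute mult_1)
qed

text \<open>Leibniz rule for amplitude times \<open>E\<close>; the phases \<open>w\<close> do not
  depend on the spectral variable. For \<open>j > 0\<close> the first entry of \<open>v j\<close> is
  0, since \<open>lam0\<close> is held fixed.\<close>

lemma Y_eq: "Y x t n $ i = w x t $ i * (\<Sum>j=0..n. of_nat (n choose j) * v j $ i * E_d x t (n - j))"
proof -
  consider "i = 1" | "i = 2" | "i = 3"
    using exhaust_3 by blast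
  thus ?thesis
  proof cases
    case 1
    have "(deriv ^^ n) (\<lambda>z. lam0 * E x t z) chi0 =
        (\<Sum>j=0..n. of_nat (n choose j) * (deriv ^^ j) (\<lambda>z. lam0) chi0 * (deriv ^^ (n - j)) (E x t) chi0)"
      by (rule higher_deriv_mult_at[OF _ E_analytic]) (intro analytic_intros)
    thus ?thesis
      using 1 by (simp add: Y_def y_def v_def w_def E_d_def)
  next
    case 2
    have "(deriv ^^ n) (\<lambda>z. (u10 x t) * (h1 z * E x t z)) chi0 = u10 x t *
        (\<Sum>j=0..n. of_nat (n choose j) * (deriv ^^ j) h1 chi0 * (deriv ^^ (n - j)) (E x t) chi0)"
      by (subst higher_deriv_cmult', intro analytic_intros h_analytic E_analytic)
        (simp only: higher_deriv_mult_at[OF h_analytic(1) E_analytic])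
    thus ?thesis
      using 2 by (simp add: Y_def y_def v_def u10_w E_d_def sum_distrib_left mult_ac)
  next
    case 3
    have "(deriv ^^ n) (\<lambda>z. (u20 x t) * (h2 z * E x t z)) chi0 = u20 x t *
        (\<Sum>j=0..n. of_nat (n choose j) * (deriv ^^ j) h2 chi0 * (deriv ^^ (n - j)) (E x t) chi0)"
      by (subst higher_deriv_cmult', intro analytic_intros h_analytic E_analytic)
        (simp only: higher_deriv_mult_at[OF h_analytic(2) E_analytic])
    thus ?thesis
      using 3 by (simp add: Y_def y_def v_def u20_w E_d_def sum_distrib_left mult_ac)
  qed
qed

text \<open>The part of the amplitude of \<open>ymu\<close> that is constant in \<open>t\<close>,
  completing \<open>pT1\<close> and \<open>pT2\<close>.\<close>

definition pT0 :: "complex^3" where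
  "pT0 = (1 / (2 * lam0)) *s vector [1, 0, 0] + (M3 / 6) *s v 3 + (M4 / 24) *s v 4 + (M5 / 120) *s v 5"

definition r :: "real \<Rightarrow> complex^3" where
  "r t = rT + (of_real t * cT) *s v 0"

definition p :: "real \<Rightarrow> complex^3" where
  "p t = pT0 + of_real t *s pT1 + (of_real t)^2 *s pT2"

text \<open>Growth comes only from \<open>E_d 2\<close>, whose factor \<open>M2 / 2\<close> turns
  \<open>i nu_2 t\<close> into \<open>cT t\<close>.\<close>

lemma yR_stationary:
  "yR (- t / (3 * k^2)) t $ i = (E (- t / (3 * k^2)) t chi0 * w (- t / (3 * k^2)) t $ i) * r t $ i"
proof -
  define x where "x = - t / (3 * k^2)"
  define e where "e = E x t chi0"
  note Es = E_d_stationary[of t, folded x_def, folded e_def]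
  have E0: "E_d x t 0 = e"
    by (simp add: E_d_0 e_def)
  have Y0: "Y x t 0 $ i = w x t $ i * (v 0 $ i * e)"
    by (simp add: Y_eq E0)
  have Y1: "Y x t 1 $ i = w x t $ i * (v 1 $ i * e)"
    using Es(1) by (simp add: Y_eq E0)
  have Y2: "Y x t 2 $ i = w x t $ i * (v 0 $ i * E_d x t 2 + v 2 $ i * e)"
    using Es(1) by (simp add: Y_eq E0 eval_nat_numeral)
  show ?thesis
    unfolding x_def[symmetric] e_def[symmetric]
    by (simp add: yR_def Y0 Y1[unfolded One_nat_def] Y2 Es(2) r_def rT_def cT_def algebra_simps)
qed

lemma ymu_stationary:
  "ymu (- t / (3 * k^2)) t $ i = (E (- t / (3 * k^2)) t chi0 * w (- t / (3 * k^2)) t $ i) * p t $ i"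
proof -
  define x where "x = - t / (3 * k^2)"
  define e where "e = E x t chi0"
  define T where "T = complex_of_real t"
  note Es = E_d_stationary[of t, folded x_def, folded e_def T_def]
  have E0: "E_d x t 0 = e"
    by (simp add: E_d_0 e_def)
  have Y3: "Y x t 3 $ i = w x t $ i * (v 0 $ i * E_d x t 3 + 3 * v 1 $ i * E_d x t 2 + v 3 $ i * e)"
    using Es(1) by (simp add: Y_eq E0 eval_nat_numeral)
  have Y4: "Y x t 4 $ i = w x t $ i * (v 0 $ i * E_d x t 4 + 4 * v 1 $ i * E_d x t 3
      + 6 * v 2 $ i * E_d x t 2 + v 4 $ i * e)"
    using Es(1) by (simp add: Y_eq E0 eval_nat_numeral)
  have Y5: "Y x t 5 $ i = w x t $ i * (v 0 $ i * E_d x t 5 + 5 * v 1 $ i * E_d x t 4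
      + 10 * v 2 $ i * E_d x t 3 + 10 * v 3 $ i * E_d x t 2 + v 5 $ i * e)"
    using Es(1) by (simp add: Y_eq E0 eval_nat_numeral)
  \<comment> \<open>The extra term of \<open>ymu\<close> has only a first component, where
    \<open>w\<close> is 1, so \<open>w\<close> can be factored out of it too.\<close>
  define b where "b = (vector [1, 0, 0] :: complex^3)"
  have b: "(vector [z, 0, 0] :: complex^3) $ i = w x t $ i * (z * b $ i)" for z
    using exhaust_3[of i] by (auto simp: b_def w_def)
  \<comment> \<open>Naming the reciprocal leaves an identity without division by
    \<open>lam0\<close>.\<close>
  define l where "l = 1 / (2 * lam0)"
  have l: "z / (2 * lam0) = z * l" "z / (4 * lam0) = z * l / 2" for z
    by (simp_all add: l_def)
  have "ymu x t $ i = w x t $ i * (1 / (2 * lam0) * ((e + M2 / 2 * E_d x t 2) * b $ i))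
     + M3 / 6 * Y x t 3 $ i + M4 / 24 * Y x t 4 $ i + M5 / 120 * Y x t 5 $ i"
    using Es(1) by (simp add: ymu_def E0 b[of "_ + _"])
  also have "\<dots> = (e * w x t $ i) * p t $ i"
    unfolding Y3 Y4 Y5 Es p_def pT0_def pT1_def pT2_def b_def[symmetric] T_def[symmetric] l
    by (simp add: field_simps power2_eq_square)
  finally show ?thesis
    unfolding x_def e_def .
qed

section \<open>Isotropy of \<open>v 0\<close> and its orthogonality to \<open>v 1\<close>\<close>

lemma v0: "v 0 = vector [of_real L, of_real (a1 * (k / (k + c))), of_real (a2 * (k / (k - c)))]"
  by (simp add: v_def lam0_eq h1_chi0 h2_chi0)

lemma v1: "v 1 = vector [0, of_real (a1 * (- k / (k + c)^2)), of_real (a2 * (k / (k - c)^2))]"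
  by (simp add: v_def deriv_h1 deriv_h2)

text \<open>That both quotients have the same value makes the second and third components cancel in
  \<open>v0_J_v1\<close>.\<close>

lemma A_div: "A / (k + c)^3 = 1 / (3 * c * k^3)" and B_div: "B / (k - c)^3 = 1 / (3 * c * k^3)"
  using A_eq B_eq c_pos k_nz k_plus_nz k_minus_nz by (simp_all add: field_simps)

lemma v0_weights:
  "(a1 * (k / (k + c)))^2 = (k + c) / (3 * c * k)"
  "(a2 * (k / (k - c)))^2 = (k - c) / (3 * c * k)"
proof -
  have "(a1 * (k / (k + c)))^2 = k^2 * (k + c) * (A / (k + c)^3)"
    using k_plus_nz a1_sq by (simp add: power_mult_distrib power_divide power2_eq_square power3_eq_cube)
  thus "(a1 * (k / (k + c)))^2 = (k + c) / (3 * c * k)"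
    unfolding A_div using k_nz by (simp add: power2_eq_square power3_eq_cube)
  have "(a2 * (k / (k - c)))^2 = k^2 * (k - c) * (B / (k - c)^3)"
    using k_minus_nz a2_sq by (simp add: power_mult_distrib power_divide power2_eq_square power3_eq_cube)
  thus "(a2 * (k / (k - c)))^2 = (k - c) / (3 * c * k)"
    unfolding B_div using k_nz by (simp add: power2_eq_square power3_eq_cube)
qed

lemma weights_sum: "(k + c) / (3 * c * k) + (k - c) / (3 * c * k) = L^2"
  unfolding L_sq using k_nz c_pos by (simp add: field_simps)

lemma v0_J_v0: "herm_form (v 0) J (v 0) = 0"
proof -
  have "herm_form (v 0) J (v 0) = of_real (L^2 - (a1 * (k / (k + c)))^2 - (a2 * (k / (k - c)))^2)"
    unfolding v0 herm_form_J by (simp add: power2_eq_square)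
  also have "\<dots> = 0"
    unfolding v0_weights weights_sum[symmetric] by simp
  finally show ?thesis .
qed

lemma kappa0_eq: "kappa0 = of_real (2 * L^2)"
proof -
  have "kappa0 = of_real (L^2 + (a1 * (k / (k + c)))^2 + (a2 * (k / (k - c)))^2)"
    unfolding kappa0_def v0 herm_form_K by (simp add: power2_eq_square)
  also have "\<dots> = of_real (2 * L^2)"
    unfolding v0_weights add.assoc weights_sum by simp
  finally show ?thesis .
qed

lemma v0_J_v1: "herm_form (v 0) J (v 1) = 0"
proof -
  have "herm_form (v 0) J (v 1) = of_real (k^2 * (a1^2 / (k + c)^3) - k^2 * (a2^2 / (k - c)^3))"
    unfolding v0 v1 herm_form_J by (simp add: power2_eq_square power3_eq_cube mult_ac)
  also have "\<dots> = 0"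
    unfolding a1_sq a2_sq A_div B_div by simp
  finally show ?thesis .
qed

text \<open>\<open>pT2\<close> lies in the span of \<open>v 0\<close> and
  \<open>v 1\<close>.\<close>

lemma v0_J_pT2: "herm_form (v 0) J pT2 = 0"
proof -
  have "herm_form (v 0) J pT2 = - (nu_d 2 ^ 2 * M4 / 8 + nu_d 2 * nu_d 3 * M5 / 12) * herm_form (v 0) J (v 0)
     - (nu_d 2 ^ 2 * M5 / 8) * herm_form (v 0) J (v 1)"
    unfolding pT2_def herm_form_J by (simp add: algebra_simps)
  thus ?thesis
    by (simp only: v0_J_v0 v0_J_v1) simp
qed

section \<open>Quadratic growth of the denominator\<close>

text \<open>A linear amplitude meets a quadratic one; the cubic coefficient pairs \<open>v 0\<close>
  with \<open>pT2\<close> and vanishes. Only the top coefficient matters later, so the others stay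
  anonymous.\<close>

lemma r_J_p:
  obtains z0 z1 where "\<And>t. herm_form (r t) J (p t) = z0 + of_real t * z1 + of_real t ^ 2 * zetaT2"
proof
  fix t
  have "herm_form (r t) J (p t) = herm_form rT J pT0
      + of_real t * (herm_form rT J pT1 + cnj cT * herm_form (v 0) J pT0)
      + of_real t ^ 2 * zetaT2 + of_real t ^ 3 * (cnj cT * herm_form (v 0) J pT2)"
    unfolding r_def p_def zetaT2_def herm_form_J
    by (simp add: algebra_simps power2_eq_square power3_eq_cube)
  thus "herm_form (r t) J (p t) = herm_form rT J pT0
      + of_real t * (herm_form rT J pT1 + cnj cT * herm_form (v 0) J pT0)
      + of_real t ^ 2 * zetaT2"
    by (simp add: v0_J_pT2)
qed

lemma mR_stationary:
  obtains m0 m1 where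
    "\<And>t. mR (- t / (3 * k^2)) t = m0 + of_real t * m1 + of_real t ^ 2 * dT"
proof -
  obtain z0 z1 where rp: "\<And>t. herm_form (r t) J (p t) = z0 + of_real t * z1 + of_real t ^ 2 * zetaT2"
    using r_J_p by blast
  \<comment> \<open>This replaces the imaginary part in \<open>dT\<close> by \<open>zetaT2\<close>
    and its conjugate, the form in which the two \<open>J\<close> terms of \<open>mR\<close> produce
    it.\<close>
  have diff: "zetaT2 - cnj zetaT2 = 2 * \<i> * of_real (Im zetaT2)"
    by (simp add: complex_diff_cnj)
  have d: "dT = lam0 * (cnj zetaT2 - zetaT2) - cT * cnj cT * kappa0 / (2 * lam0)"
    using diff unfolding dT_def complex_norm_square by algebra
  show ?thesis
  proof
    fix t
    define x where "x = - t / (3 * k^2)"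
    have "mR x t = lam0 * (herm_form (p t) J (r t) - herm_form (r t) J (p t))
        - herm_form (r t) K (r t) / (2 * lam0)"
      unfolding mR_def x_def
      by (simp only: herm_form_J_unitary[OF phase_unit ymu_stationary yR_stationary]
        herm_form_J_unitary[OF phase_unit yR_stationary ymu_stationary]
        herm_form_K_unitary[OF phase_unit yR_stationary yR_stationary])
    also have "herm_form (p t) J (r t) = cnj (herm_form (r t) J (p t))"
      by (simp add: cnj_herm_form_J)
    also have "herm_form (r t) K (r t) = herm_form rT K rT
        + of_real t * (cT * herm_form rT K (v 0) + cnj cT * herm_form (v 0) K rT)
        + of_real t ^ 2 * (cT * cnj cT * kappa0)"
      unfolding r_def kappa0_def herm_form_K by (simp add: algebra_simps power2_eq_square)
    finally show "mR (- t / (3 * k^2)) t = (lam0 * (cnj z0 - z0) - herm_form rT K rT / (2 * lam0))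
       + of_real t * (lam0 * (cnj z1 - z1)
           - (cT * herm_form rT K (v 0) + cnj cT * herm_form (v 0) K rT) / (2 * lam0))
       + of_real t ^ 2 * dT"
      unfolding rp x_def d by (simp add: algebra_simps add_divide_distrib)
  qed
qed

lemma cT_nz: "cT \<noteq> 0"
  using nu_d_2_nz M2_nz by (simp add: cT_def)

text \<open>As \<open>lam0\<close> is real, the \<open>zetaT2\<close> term is purely imaginary, and
  the real part is -|\<open>cT\<close>|^2 \<open>L\<close>.\<close>

lemma dT_nz: "dT \<noteq> 0"
proof -
  have "Re dT = - (cmod cT ^ 2 * (2 * L^2) / (2 * L))"
    unfolding dT_def kappa0_eq lam0_eq by (simp del: of_real_power of_real_mult flip: of_real_mult of_real_divide)
  also have "\<dots> < 0"
    using cT_nz L_pos by simp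
  finally show ?thesis
    by auto
qed

lemma a_nz: "a1 \<noteq> 0" "a2 \<noteq> 0"
  using a1_sq a2_sq A_pos B_pos by auto

section \<open>The plateau limits and their common parameter\<close>

text \<open>Serves both components: \<open>a\<close> is the background amplitude and
  \<open>h\<close> the value of \<open>h1\<close> or \<open>h2\<close> at the root. The two
  numerator factors grow like \<open>cnj cT * lam0 * t\<close> and
  \<open>cT * h * t\<close>.\<close>

lemma tendsto_ratio:
  fixes i :: 3 and a :: complex
  assumes "\<And>t. ratio t = 1 + 2 * cnj (yR (- t / (3 * k^2)) t $ 1) / mR (- t / (3 * k^2)) t
      * yR (- t / (3 * k^2)) t $ i / (a * w (- t / (3 * k^2)) t $ i)"
    and "a \<noteq> 0" and "v 0 $ i = a * h"
  shows "(ratio \<longlongrightarrow> 1 + 2 * of_real (cmod cT ^ 2) * lam0 * h / dT) at_infinity"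
proof -
  obtain m0 m1 where m:
    "\<And>t. mR (- t / (3 * k^2)) t = m0 + of_real t * m1 + of_real t ^ 2 * dT"
    using mR_stationary by blast
  have "ratio t = 1 + 2 * (cnj (rT $ 1) + of_real t * (cnj cT * lam0)) * (rT $ i / a + of_real t * (cT * h))
      / (m0 + of_real t * m1 + of_real t ^ 2 * dT)" for t
  proof -
    define x where "x = - t / (3 * k^2)"
    define e where "e = E x t chi0"
    have e: "cnj e * e = 1"
      using phase_unit[of x t 1] by (simp add: w_def e_def)
    have wnz: "w x t $ i \<noteq> 0"
      using phase_unit[of x t i] by auto
    have y1: "yR x t $ 1 = e * r t $ 1"
      using yR_stationary[of t 1] by (simp add: x_def e_def w_def)
    \<comment> \<open>Division by the background removes \<open>w\<close>; the remaining
      \<open>e\<close> meets its conjugate from the first component.\<close>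
    have yi: "yR x t $ i / (a * w x t $ i) = e * (r t $ i / a)"
      using yR_stationary[of t i] wnz by (simp add: x_def e_def)
    have "ratio t = 1 + 2 * cnj (yR x t $ 1) / mR x t * (yR x t $ i / (a * w x t $ i))"
      unfolding assms(1) x_def by simp
    also have "\<dots> = 1 + 2 * (cnj e * e) * cnj (r t $ 1) * (r t $ i / a) / mR x t"
      unfolding y1 yi by (simp add: mult_ac)
    also have "\<dots> = 1 + 2 * cnj (r t $ 1) * (r t $ i / a) / mR x t"
      unfolding e by simp
    also have "cnj (r t $ 1) = cnj (rT $ 1) + of_real t * (cnj cT * lam0)"
      by (simp add: r_def v_def lam0_eq)
    also have "r t $ i / a = rT $ i / a + of_real t * (cT * h)"
      using assms(2,3) by (simp add: r_def add_divide_distrib)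
    finally show ?thesis
      unfolding x_def m .
  qed
  hence "ratio = (\<lambda>t. 1 + 2 * (cnj (rT $ 1) + of_real t * (cnj cT * lam0)) * (rT $ i / a + of_real t * (cT * h))
      / (m0 + of_real t * m1 + of_real t ^ 2 * dT))"
    by blast
  moreover have "2 * (cnj cT * lam0) * (cT * h) = 2 * of_real (cmod cT ^ 2) * lam0 * h"
    unfolding complex_norm_square by simp
  ultimately show ?thesis
    using tendsto_plateau[OF dT_nz, of "cnj (rT $ 1)" "cnj cT * lam0" "rT $ i / a" "cT * h" m0 m1]
    by (simp only:)
qed

lemma tendsto_ratio1: "(ratio1 \<longlongrightarrow> 1 + 2 * of_real (cmod cT ^ 2) * lam0 * h1 chi0 / dT) at_infinity"
proof (rule tendsto_ratio)
  fix t
  show "ratio1 t = 1 + 2 * cnj (yR (- t / (3 * k^2)) t $ 1) / mR (- t / (3 * k^2)) t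
      * yR (- t / (3 * k^2)) t $ 2 / (of_real a1 * w (- t / (3 * k^2)) t $ 2)"
    using a_nz phase_unit[of "- t / (3 * k^2)" t 2]
    by (auto simp: ratio1_def u1_def u10_w add_divide_distrib)
qed (use a_nz in \<open>auto simp: v_def\<close>)

lemma tendsto_ratio2: "(ratio2 \<longlongrightarrow> 1 + 2 * of_real (cmod cT ^ 2) * lam0 * h2 chi0 / dT) at_infinity"
proof (rule tendsto_ratio)
  fix t
  show "ratio2 t = 1 + 2 * cnj (yR (- t / (3 * k^2)) t $ 1) / mR (- t / (3 * k^2)) t
      * yR (- t / (3 * k^2)) t $ 3 / (of_real a2 * w (- t / (3 * k^2)) t $ 3)"
    using a_nz phase_unit[of "- t / (3 * k^2)" t 3]
    by (auto simp: ratio2_def u2_def u20_w add_divide_distrib)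
qed (use a_nz in \<open>auto simp: v_def\<close>)

lemma P1_eq: "P1 = 1 + 2 * of_real (cmod cT ^ 2) * lam0 * h1 chi0 / dT"
  and P2_eq: "P2 = 1 + 2 * of_real (cmod cT ^ 2) * lam0 * h2 chi0 / dT"
  unfolding P1_def P2_def
  by (intro tendsto_Lim tendsto_ratio1 tendsto_ratio2 trivial_limit_at_infinity)+

text \<open>The factors \<open>1 + q_tri\<close> and \<open>1 - q_tri\<close> are the reciprocals of
  the amplitudes at the root, the only place where the two plateau factors differ.\<close>

lemma q_h: "(1 + q_tri) * h1 chi0 = 1" "(1 - q_tri) * h2 chi0 = 1"
proof -
  have "1 + q_tri = (of_real k + chi0) / of_real k" "1 - q_tri = (of_real k - chi0) / of_real k"
    using k_nz by (simp_all add: q_tri_def add_divide_distrib diff_divide_distrib)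
  thus "(1 + q_tri) * h1 chi0 = 1" "(1 - q_tri) * h2 chi0 = 1"
    using k_chi0_nz k_nz by (simp_all add: h1_def h2_def)
qed

lemma plateau_link: "(1 + q_tri) * (P1 - 1) = CT" "(1 - q_tri) * (P2 - 1) = CT"
proof -
  have "(1 + q_tri) * (P1 - 1) = CT * ((1 + q_tri) * h1 chi0)"
       "(1 - q_tri) * (P2 - 1) = CT * ((1 - q_tri) * h2 chi0)"
    by (simp_all add: P1_eq P2_eq CT_def)
  thus "(1 + q_tri) * (P1 - 1) = CT" "(1 - q_tri) * (P2 - 1) = CT"
    by (simp_all add: q_h)
qed

end

theorem corollary43:
  fixes A B k a1 a2 x0 t0 :: real and chi0 mu0 M1 M2 :: complex
  defines "g \<equiv> triple_root_wave.g A B k a1 a2 chi0 mu0 x0 t0"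
    and "lam0 \<equiv> triple_root_wave.lam0 mu0"
    and "h1 \<equiv> triple_root_wave.h1 k"
    and "h2 \<equiv> triple_root_wave.h2 k"
    and "cT \<equiv> triple_root_wave.cT A B k chi0 M2"
    and "dT \<equiv> triple_root_wave.dT A B k a1 a2 chi0 mu0 M1 M2"
    and "CT \<equiv> triple_root_wave.CT A B k a1 a2 chi0 mu0 M1 M2"
    and "q \<equiv> triple_root_wave.q_tri k chi0"
    and "ratio1 \<equiv> triple_root_wave.ratio1 A B k a1 a2 chi0 mu0 M1 M2"
    and "ratio2 \<equiv> triple_root_wave.ratio2 A B k a1 a2 chi0 mu0 M1 M2"
    and "P1 \<equiv> triple_root_wave.P1 A B k a1 a2 chi0 mu0 M1 M2"
    and "P2 \<equiv> triple_root_wave.P2 A B k a1 a2 chi0 mu0 M1 M2"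
  assumes "A > 0" and "B > 0" and "k \<noteq> 0"
    and "a1^2 = A" and "a2^2 = B"
    and "\<forall>z. triple_root_wave.F A B k z mu0 = mu0 * (z - chi0)^3"
    and "M2 \<noteq> 0"
    and "g 1 1 * of_real (cmod M1 ^ 2) + g 0 2 * of_real (Re M2)
          + of_real (Re (g 1 2 * cnj M1 * M2)) + g 2 2 / 4 * of_real (cmod M2 ^ 2) = 0"
  shows "dT \<noteq> 0
    \<and> (ratio1 \<longlongrightarrow> P1) at_infinity \<and> P1 = 1 + 2 * of_real (cmod cT ^ 2) * lam0 * h1 chi0 / dT
    \<and> (ratio2 \<longlongrightarrow> P2) at_infinity \<and> P2 = 1 + 2 * of_real (cmod cT ^ 2) * lam0 * h2 chi0 / dT
    \<and> (1 + q) * (P1 - 1) = (1 - q) * (P2 - 1) \<and> (1 - q) * (P2 - 1) = CT"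
proof -
  \<comment> \<open>The locale parameter \<open>c\<close> is instantiated with the real part of the
    root, so \<open>c_def\<close> holds by reflexivity.\<close>
  interpret triple_root A B k a1 a2 chi0 mu0 M1 M2 "Re chi0"
    using assms by unfold_locales auto
  show ?thesis
    unfolding assms(2-12)
    using dT_nz tendsto_ratio1 tendsto_ratio2 P1_eq P2_eq plateau_link by simp
qed

end
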